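(* Let $I\subset\mathbb R\setminus\{0\}$ be an open interval and $f:I\to\mathbb R$ smooth with $f'^2<1$, $f'\neq0$ and $f''\neq0$ everywhere on $I$. If the differential equation $$\frac{f'''}{f''}=\frac{s(3f'^2+2)f''+2f'(f'^2-1)}{sf'(f'^2-1)}$$ holds on $I$, then the rotational hypersurface $\Gamma^s(s,t,w)=(s\cosh t\cosh w,\ s\sinh t,\ s\cosh t\sinh w,\ f(s))$ in $\mathbb E_1^4$ with Gauss map $N^{s}=-\frac{1}{\sqrt{1-f'^2}}(f'\cosh t\cosh w,\ f'\sinh t,\ f'\cosh t\sinh w,\ 1)$ has first kind $L_2$-pointwise 1-type Gauss map, i.e. $L_2N^s=\mathfrak mN^s$ for some non-zero smooth function $\mathfrak m$.
   Context: $\mathbb E_1^4$ is $\mathbb R^4$ with the Lorentzian metric $\langle\,,\rangle=-dx_1^2+dx_2^2+dx_3^2+dx_4^2$. Let $M$ be an oriented hypersurface of $\mathbb E_1^4$ with nondegenerate induced metric $g$, unit normal vector field (Gauss map) $N$, $\varepsilon=\langle N,N\rangle=\pm1$, shape operator $S=-dN$ and principal curvatures $\kappa_1,\kappa_2,\kappa_3$. Put $a_0=1$, $a_1=-(\kappa_1+\kappa_2+\kappa_3)$, $a_2=\kappa_1\kappa_2+\kappa_1\kappa_3+\kappa_2\kappa_3$, $a_3=-\kappa_1\kappa_2\kappa_3$. The Newton transformations are $P_0=I$, $P_k=a_kI+S\circ P_{k-1}$, and $L_k(\varphi)=\mathrm{tr}(P_k\circ\nabla^2\varphi)$ for $\varphi\in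 C^\infty(M)$, where $\nabla^2\varphi$ is the Hessian operator of $\varphi$ with respect to $g$; $L_k$ acts componentwise on $\mathbb R^4$-valued functions such as $N$. With $n=3$, $\binom{n}{k}H_k=(-\varepsilon)^ka_k$ and $C_k=\binom{n}{k+1}(-\varepsilon)^k$, the known formula used for the Gauss map is $L_kN=-\varepsilon C_k\big(\nabla H_{k+1}+(nH_1H_{k+1}-(n-k-1)H_{k+2})N\big)$, where $\nabla$ is the gradient of $g$ (for $k=2$ the last term has coefficient $0$). $M$ has first kind $L_k$-pointwise 1-type Gauss map if $L_kN=\mathfrak mN$ for a non-zero (i.e. not identically zero) smooth function $\mathfrak m$ on $M$. Primes denote $d/ds$; $s\in I$ and $t,w\in\mathbb R$. *)

theory Defs
  imports "HOL-Analysis.Analysis"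
begin

section \<open>Smooth functions on open sets\<close>

text \<open>Class \<open>C^k\<close>: every directional derivative is of class \<open>C^(k-1)\<close>. Only meant for open \<open>U\<close>,
  since the derivatives are taken in the whole space.\<close>

fun C_on :: "nat \<Rightarrow> 'a set \<Rightarrow> ('a::real_normed_vector \<Rightarrow> 'b::real_normed_vector) \<Rightarrow> bool" where
  "C_on 0 U f = continuous_on U f"
| "C_on (Suc k) U f =
     ((\<forall>x\<in>U. f differentiable (at x)) \<and> (\<forall>v. C_on k U (\<lambda>x. frechet_derivative f (at x) v)))"

definition smooth_on :: "'a set \<Rightarrow> ('a::real_normed_vector \<Rightarrow> 'b::real_normed_vector) \<Rightarrow> bool" where
  "smooth_on U f \<longleftrightarrow> (\<forall>k. C_on k U f)"

definition partial :: "'n \<Rightarrow> (real^'n \<Rightarrow> 'b::real_normed_vector) \<Rightarrow> real^'n \<Rightarrow> 'b" where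
  "partial i f p = frechet_derivative f (at p) (axis i 1)"

section \<open>Hypersurfaces of Minkowski 4-space\<close>

definition lorentz :: "real^4 \<Rightarrow> real^4 \<Rightarrow> real" where
  "lorentz x y = - x$1 * y$1 + x$2 * y$2 + x$3 * y$3 + x$4 * y$4"

text \<open>A hypersurface is given by a global parametrization \<open>X\<close> on an open set \<open>U\<close> of parameters, so
  that functions on the hypersurface are functions on \<open>U\<close>. Tangent vectors are written in the
  coordinate basis \<open>partial j X p\<close>, and operators on the tangent space are matrices
  with respect to it: column \<open>j\<close> holds the coefficients of the image of the \<open>j\<close>-th basis vector.\<close>

definition metric :: "(real^3 \<Rightarrow> real^4) \<Rightarrow> real^3 \<Rightarrow> real^3^3" where
  "metric X p = (\<chi> i j. lorentz (partial i X p) (partial j X p))"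

definition oriented_hypersurface ::
    "(real^3) set \<Rightarrow> (real^3 \<Rightarrow> real^4) \<Rightarrow> (real^3 \<Rightarrow> real^4) \<Rightarrow> bool" where
  "oriented_hypersurface U X N \<longleftrightarrow>
     open U \<and> smooth_on U X \<and> inj_on X U \<and>
     (\<forall>p\<in>U. inj (frechet_derivative X (at p))) \<and>
     (\<forall>p\<in>U. det (metric X p) \<noteq> 0) \<and>
     smooth_on U N \<and>
     (\<forall>p\<in>U. \<forall>i. lorentz (N p) (partial i X p) = 0) \<and>
     (\<exists>\<epsilon>\<in>{1, -1}. \<forall>p\<in>U. lorentz (N p) (N p) = \<epsilon>)"

text \<open>The equation \<open>S = - dN\<close> on the coordinate basis.\<close>

definition shape_operator ::
    "(real^3 \<Rightarrow> real^4) \<Rightarrow> (real^3 \<Rightarrow> real^4) \<Rightarrow> real^3 \<Rightarrow> real^3^3" where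
  "shape_operator X N p =
     (THE S. \<forall>j. (\<Sum>i\<in>UNIV. S$i$j *\<^sub>R partial i X p) = - partial j N p)"

text \<open>The components of \<open>\<kappa>\<close> are the eigenvalues of \<open>S\<close> with algebraic multiplicity, in any order.\<close>

definition principal_curvatures :: "real^3^3 \<Rightarrow> real^3 \<Rightarrow> bool" where
  "principal_curvatures S \<kappa> \<longleftrightarrow> (\<forall>x. det (mat x - S) = (\<Prod>i\<in>UNIV. (x - \<kappa>$i)))"

definition a_coeff :: "real^3 \<Rightarrow> nat \<Rightarrow> real" where
  "a_coeff \<kappa> k =
     (if k = 0 then 1
      else if k = 1 then - (\<kappa>$1 + \<kappa>$2 + \<kappa>$3)
      else if k = 2 then \<kappa>$1 * \<kappa>$2 + \<kappa>$1 * \<kappa>$3 + \<kappa>$2 * \<kappa>$3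
      else if k = 3 then - (\<kappa>$1 * \<kappa>$2 * \<kappa>$3)
      else 0)"

fun newton_transformation :: "real^3^3 \<Rightarrow> real^3 \<Rightarrow> nat \<Rightarrow> real^3^3" where
  "newton_transformation S \<kappa> 0 = mat 1"
| "newton_transformation S \<kappa> (Suc k) =
     mat (a_coeff \<kappa> (Suc k)) + S ** newton_transformation S \<kappa> k"

section \<open>The Hessian operator and the operators \<open>L\<^sub>k\<close>\<close>

text \<open>Christoffel symbols of the second kind of the Levi-Civita connection; \<open>k\<close> is the upper index.\<close>

definition christoffel :: "(real^3 \<Rightarrow> real^4) \<Rightarrow> 3 \<Rightarrow> 3 \<Rightarrow> 3 \<Rightarrow> real^3 \<Rightarrow> real" where
  "christoffel X k i j p =
     (1/2) * (\<Sum>l\<in>UNIV. matrix_inv (metric X p) $ k $ l *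
       (partial i (\<lambda>q. metric X q $ j $ l) p
        + partial j (\<lambda>q. metric X q $ i $ l) p
        - partial l (\<lambda>q. metric X q $ i $ j) p))"

definition covariant_hessian :: "(real^3 \<Rightarrow> real^4) \<Rightarrow> (real^3 \<Rightarrow> real) \<Rightarrow> real^3 \<Rightarrow> real^3^3" where
  "covariant_hessian X \<phi> p =
     (\<chi> i j. partial i (partial j \<phi>) p - (\<Sum>k\<in>UNIV. christoffel X k i j p * partial k \<phi> p))"

text \<open>The operator \<open>H\<close> with \<open>g (H v) w = covariant_hessian v w\<close>.\<close>

definition hessian_operator :: "(real^3 \<Rightarrow> real^4) \<Rightarrow> (real^3 \<Rightarrow> real) \<Rightarrow> real^3 \<Rightarrow> real^3^3" where
  "hessian_operator X \<phi> p = matrix_inv (metric X p) ** covariant_hessian X \<phi> p"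

definition L_op ::
    "nat \<Rightarrow> (real^3 \<Rightarrow> real^4) \<Rightarrow> (real^3 \<Rightarrow> real^4) \<Rightarrow> (real^3 \<Rightarrow> real^3) \<Rightarrow>
     (real^3 \<Rightarrow> real) \<Rightarrow> real^3 \<Rightarrow> real" where
  "L_op k X N \<kappa> \<phi> p =
     trace (newton_transformation (shape_operator X N p) (\<kappa> p) k ** hessian_operator X \<phi> p)"

definition L_op_vec ::
    "nat \<Rightarrow> (real^3 \<Rightarrow> real^4) \<Rightarrow> (real^3 \<Rightarrow> real^4) \<Rightarrow> (real^3 \<Rightarrow> real^3) \<Rightarrow>
     (real^3 \<Rightarrow> real^4) \<Rightarrow> real^3 \<Rightarrow> real^4" where
  "L_op_vec k X N \<kappa> F p = (\<chi> c. L_op k X N \<kappa> (\<lambda>q. F q $ c) p)"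

text \<open>The principal curvatures \<open>\<kappa> p\<close> are determined up to order, and \<open>L_op_vec\<close> is symmetric in
  them, so the existential quantifier over \<open>\<kappa>\<close> involves no choice.\<close>

definition first_kind_L_pointwise_1_type_Gauss_map ::
    "nat \<Rightarrow> (real^3) set \<Rightarrow> (real^3 \<Rightarrow> real^4) \<Rightarrow> (real^3 \<Rightarrow> real^4) \<Rightarrow> bool" where
  "first_kind_L_pointwise_1_type_Gauss_map k U X N \<longleftrightarrow>
     (\<exists>\<kappa> m. (\<forall>p\<in>U. principal_curvatures (shape_operator X N p) (\<kappa> p)) \<and>
        smooth_on U m \<and> (\<exists>p\<in>U. m p \<noteq> 0) \<and>
        (\<forall>p\<in>U. L_op_vec k X N \<kappa> N p = m p *\<^sub>R N p))"

section \<open>The rotational hypersurface\<close>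

text \<open>The parameter \<open>p\<close> is \<open>(s, t, w)\<close>.\<close>

definition rot_hypersurface :: "(real \<Rightarrow> real) \<Rightarrow> real^3 \<Rightarrow> real^4" where
  "rot_hypersurface f p = (let s = p$1; t = p$2; w = p$3 in
     vector [s * cosh t * cosh w, s * sinh t, s * cosh t * sinh w, f s])"

definition rot_gauss_map :: "(real \<Rightarrow> real) \<Rightarrow> real^3 \<Rightarrow> real^4" where
  "rot_gauss_map f p = (let s = p$1; t = p$2; w = p$3 in
     (- 1 / sqrt (1 - (deriv f s)\<^sup>2)) *\<^sub>R
     vector [deriv f s * cosh t * cosh w, deriv f s * sinh t, deriv f s * cosh t * sinh w, 1])"

end

theory Submission
  imports Defs
begin

text \<open>Let \<open>e(t, w) = (cosh t cosh w, sinh t, cosh t sinh w)\<close> and \<open>\<omega> = 1 / sqrt (1 - f'\<^sup>2)\<close>.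
  In the coordinates \<open>(s, t, w)\<close> the metric is diagonal with entries \<open>f'\<^sup>2 - 1\<close>, \<open>s\<^sup>2\<close>, \<open>s\<^sup>2 cosh\<^sup>2 t\<close>, and
  the shape operator is diagonal with entries \<open>\<kappa>1 = f'' \<omega>\<^sup>3\<close> and, twice, \<open>\<kappa>2 = f' \<omega> / s\<close>. Hence \<open>P\<^sub>2\<close>
  is diagonal, and \<open>L\<^sub>2\<close> only involves the diagonal of the Hessian. On \<open>N = - \<omega> (f' e, 1)\<close> it gives
  \<open>(A(s) e, B(s))\<close>. The differential equation says that \<open>\<kappa>1 \<kappa>2\<^sup>2\<close> is constant; using it to eliminate
  \<open>f'''\<close> turns this into \<open>\<mu> N\<close> with \<open>\<mu> = - \<kappa>1 \<kappa>2\<^sup>2 (\<kappa>1 + 2 \<kappa>2)\<close>.\<close>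

section \<open>Calculus of smooth functions\<close>

lemma C_on_SucD:
  assumes "C_on (Suc k) U f" "x \<in> U"
  shows "(f has_derivative frechet_derivative f (at x)) (at x)"
  using assms frechet_derivative_works by auto

text \<open>Since \<open>U\<close> is open, derivatives at its points depend only on the values on
  \<open>U\<close>; this locality carries the induction through the directional derivatives.\<close>

lemma C_on_cong:
  assumes "open U" "\<And>x. x \<in> U \<Longrightarrow> f x = g x" "C_on k U f"
  shows "C_on k U g"
  using assms(2,3)
proof (induction k arbitrary: f g)
  case 0
  then show ?case using continuous_on_cong[of U U f g] by simp
next
  case (Suc k)
  have d: "(g has_derivative frechet_derivative f (at x)) (at x)" if "x \<in> U" for x
    using has_derivative_transform_within_open[OF C_on_SucD[OF Suc.prems(2) that] assms(1) that]
      Suc.prems(1) by blast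
  have e: "frechet_derivative f (at x) = frechet_derivative g (at x)" if "x \<in> U" for x
    using frechet_derivative_at[OF d[OF that]] .
  have "C_on k U (\<lambda>x. frechet_derivative g (at x) v)" for v
    using Suc.IH[of "\<lambda>x. frechet_derivative f (at x) v" "\<lambda>x. frechet_derivative g (at x) v"]
      e Suc.prems(2) by simp
  then show ?case using d by (auto simp: differentiable_def)
qed

text \<open>Lets an explicit derivative formula stand in for \<open>frechet_derivative\<close>, so
  that most closure properties become an induction on \<open>k\<close> over the matching
  differentiation rule.\<close>

lemma C_on_SucI:
  assumes "open U" "\<And>x. x \<in> U \<Longrightarrow> (f has_derivative f' x) (at x)" "\<And>v. C_on k U (\<lambda>x. f' x v)"
  shows "C_on (Suc k) U f"
proof -
  have e: "f' x = frechet_derivative f (at x)" if "x \<in> U" for x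
    using frechet_derivative_at[OF assms(2)[OF that]] .
  have "C_on k U (\<lambda>x. frechet_derivative f (at x) v)" for v
    by (rule C_on_cong[OF assms(1) _ assms(3)[of v]]) (simp add: e)
  then show ?thesis using assms(2) by (auto simp: differentiable_def)
qed

lemma C_on_Suc_imp: "C_on (Suc k) U f \<Longrightarrow> C_on k U f"
proof (induction k arbitrary: f)
  case 0
  then show ?case
    by (simp add: differentiable_imp_continuous_on differentiable_on_def
        differentiable_at_withinI)
next
  case (Suc k)
  then show ?case by (metis C_on.simps(2))
qed

lemma C_on_const: "open U \<Longrightarrow> C_on k U (\<lambda>x. c)"
proof (induction k arbitrary: c)
  case (Suc k)
  show ?case
    by (rule C_on_SucI[where f'="\<lambda>x v. 0"]) (use Suc in auto)
qed simp

lemma C_on_bounded_linear: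
  assumes "bounded_linear f" "open U"
  shows "C_on k U f"
proof (cases k)
  case 0
  then show ?thesis
    using assms(1) linear_continuous_on by auto
next
  case (Suc k)
  show ?thesis unfolding Suc
    by (rule C_on_SucI[where f'="\<lambda>x. f"])
      (use assms in \<open>auto intro: C_on_const bounded_linear_imp_has_derivative\<close>)
qed

lemma C_on_add:
  assumes "open U" "C_on k U f" "C_on k U g"
  shows "C_on k U (\<lambda>x. f x + g x)"
  using assms(2,3)
proof (induction k arbitrary: f g)
  case 0
  then show ?case by (auto intro: continuous_on_add)
next
  case (Suc k)
  show ?case
    by (rule C_on_SucI[OF assms(1) has_derivative_add[OF C_on_SucD[OF Suc.prems(1)] C_on_SucD[OF Suc.prems(2)]]])
      (use Suc in auto)
qed

text \<open>In the product rule each summand keeps one factor undifferentiated;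
  \<open>C_on_Suc_imp\<close> lowers that factor to class \<open>k\<close>, so the induction
  hypothesis applies to both summands.\<close>

lemma (in bounded_bilinear) C_on_bilinear:
  assumes "open U" "C_on k U f" "C_on k U g"
  shows "C_on k U (\<lambda>x. prod (f x) (g x))"
  using assms(2,3)
proof (induction k arbitrary: f g)
  case 0
  then show ?case by (auto intro: continuous_on)
next
  case (Suc k)
  have "C_on k U (\<lambda>x. prod (f x) (frechet_derivative g (at x) v) + prod (frechet_derivative f (at x) v) (g x))" for v
    using Suc.prems by (intro C_on_add[OF assms(1)] Suc.IH C_on_Suc_imp[of k U f] C_on_Suc_imp[of k U g]) auto
  then show ?case
    by (intro C_on_SucI[OF assms(1) FDERIV[OF C_on_SucD[OF Suc.prems(1)] C_on_SucD[OF Suc.prems(2)]]])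
qed

text \<open>Because the intermediate space is the real line, the chain rule yields a scalar product
  of the derivative of \<open>h\<close> with \<open>g'\<close> composed with \<open>h\<close>. The
  induction therefore varies \<open>g\<close> alone, and the product is handled by
  bilinearity.\<close>

lemma C_on_compose_real:
  fixes h :: "'a::real_normed_vector \<Rightarrow> real" and g :: "real \<Rightarrow> 'b::real_normed_vector"
  assumes "open U" "h ` U \<subseteq> I" "C_on k I g" "C_on k U h"
  shows "C_on k U (\<lambda>x. g (h x))"
  using assms(3,4)
proof (induction k arbitrary: g)
  case 0
  then show ?case using assms(2) by (auto intro: continuous_on_compose2)
next
  case (Suc k)
  let ?g = "\<lambda>y. frechet_derivative g (at y) 1" and ?h = "\<lambda>x. frechet_derivative h (at x)"
  have d: "((\<lambda>x. g (h x)) has_derivative (\<lambda>v. ?h x v *\<^sub>R ?g (h x))) (at x)" if "x \<in> U" for x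
  proof -
    have gd: "(g has_derivative frechet_derivative g (at (h x))) (at (h x))"
      using C_on_SucD[OF Suc.prems(1)] assms(2) that by blast
    have "((\<lambda>x. g (h x)) has_derivative (\<lambda>v. frechet_derivative g (at (h x)) (?h x v))) (at x)"
      using diff_chain_at[OF C_on_SucD[OF Suc.prems(2) that] gd] by (simp add: o_def)
    moreover have "frechet_derivative g (at (h x)) y = y *\<^sub>R ?g (h x)" for y
      using linear_cmul[OF has_derivative_linear[OF gd], of y 1] by simp
    ultimately show ?thesis by (rule has_derivative_eq_rhs[OF _ ext])
  qed
  have "C_on k U (\<lambda>x. ?h x v *\<^sub>R ?g (h x))" for v
    using Suc.prems
    by (intro bounded_bilinear.C_on_bilinear[OF bounded_bilinear_scaleR assms(1)] Suc.IH
        C_on_Suc_imp[of k U h]) auto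
  then show ?case
    by (intro C_on_SucI[OF assms(1) d])
qed

lemma C_on_Suc_realI:
  fixes g :: "real \<Rightarrow> real"
  assumes "open I" "\<And>x. x \<in> I \<Longrightarrow> (g has_real_derivative g' x) (at x)" "C_on k I g'"
  shows "C_on (Suc k) I g"
  using assms(2) bounded_bilinear.C_on_bilinear[OF bounded_bilinear_mult assms(1) assms(3) C_on_const[OF assms(1)]]
  by (intro C_on_SucI[OF assms(1), where f'="\<lambda>x v. g' x * v"]) (auto simp: has_field_derivative_def)

lemma smooth_on_const [intro]: "open U \<Longrightarrow> smooth_on U (\<lambda>x. c)"
  by (simp add: smooth_on_def C_on_const)

lemma smooth_on_bounded_linear: "bounded_linear f \<Longrightarrow> open U \<Longrightarrow> smooth_on U f"
  by (simp add: smooth_on_def C_on_bounded_linear)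

lemma smooth_on_add:
  "open U \<Longrightarrow> smooth_on U f \<Longrightarrow> smooth_on U g \<Longrightarrow> smooth_on U (\<lambda>x. f x + g x)"
  by (simp add: smooth_on_def C_on_add)

lemma smooth_on_mult:
  fixes f g :: "'a::real_normed_vector \<Rightarrow> real"
  shows "open U \<Longrightarrow> smooth_on U f \<Longrightarrow> smooth_on U g \<Longrightarrow> smooth_on U (\<lambda>x. f x * g x)"
  by (simp add: smooth_on_def bounded_bilinear.C_on_bilinear[OF bounded_bilinear_mult])

lemma smooth_on_compose_real:
  fixes h :: "'a::real_normed_vector \<Rightarrow> real"
  shows "open U \<Longrightarrow> h ` U \<subseteq> I \<Longrightarrow> smooth_on I g \<Longrightarrow> smooth_on U h \<Longrightarrow> smooth_on U (\<lambda>x. g (h x))"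
  unfolding smooth_on_def using C_on_compose_real by blast

lemma smooth_on_cong:
  "open U \<Longrightarrow> (\<And>x. x \<in> U \<Longrightarrow> f x = g x) \<Longrightarrow> smooth_on U f \<Longrightarrow> smooth_on U g"
  unfolding smooth_on_def using C_on_cong by blast

lemma smooth_on_sum:
  "open U \<Longrightarrow> (\<And>i. i \<in> A \<Longrightarrow> smooth_on U (f i)) \<Longrightarrow> smooth_on U (\<lambda>x. \<Sum>i\<in>A. f i x)"
  by (induction A rule: infinite_finite_induct) (auto intro: smooth_on_add)

lemma smooth_on_vec:
  fixes F :: "'a::real_normed_vector \<Rightarrow> real^'n"
  assumes "open U" "\<And>i. smooth_on U (\<lambda>x. F x $ i)"
  shows "smooth_on U F"
proof -
  have "smooth_on U (\<lambda>x. F x $ i *\<^sub>R axis i (1::real))" for i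
    using assms unfolding smooth_on_def
    by (auto intro!: bounded_bilinear.C_on_bilinear[OF bounded_bilinear_scaleR] C_on_const)
  then have "smooth_on U (\<lambda>x. \<Sum>i\<in>UNIV. F x $ i *\<^sub>R axis i (1::real))"
    by (intro smooth_on_sum assms(1))
  moreover have "(\<Sum>i\<in>UNIV. F x $ i *\<^sub>R axis i (1::real)) = F x" for x
    by (simp add: vec_eq_iff axis_def if_distrib[of "(*) _"] sum.delta cong: if_cong)
  ultimately show ?thesis by simp
qed

lemma smooth_on_imp_differentiable: "smooth_on U f \<Longrightarrow> x \<in> U \<Longrightarrow> f differentiable (at x)"
  unfolding smooth_on_def by (metis C_on.simps(2))

lemma smooth_on_imp_DERIV:
  fixes f :: "real \<Rightarrow> real"
  shows "smooth_on I f \<Longrightarrow> x \<in> I \<Longrightarrow> (f has_real_derivative deriv f x) (at x)"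
  using DERIV_deriv_iff_real_differentiable smooth_on_imp_differentiable by blast

lemma smooth_on_deriv:
  fixes f :: "real \<Rightarrow> real"
  assumes "open I" "smooth_on I f"
  shows "smooth_on I (deriv f)"
proof -
  have e: "frechet_derivative f (at x) 1 = deriv f x" if "x \<in> I" for x
    using fun_cong[OF frechet_derivative_at[OF smooth_on_imp_DERIV[OF assms(2) that,
        unfolded has_field_derivative_def]], of 1] by simp
  have "C_on k I (deriv f)" for k
  proof (rule C_on_cong[OF assms(1) e])
    have "C_on (Suc k) I f" using assms(2) by (simp only: smooth_on_def)
    then show "C_on k I (\<lambda>x. frechet_derivative f (at x) 1)" by simp
  qed
  then show ?thesis by (simp add: smooth_on_def)
qed

section \<open>Smoothness of the elementary functions that occur\<close>

lemma smooth_on_cosh_sinh: "smooth_on UNIV (cosh::real\<Rightarrow>real)" "smooth_on UNIV (sinh::real\<Rightarrow>real)"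
proof -
  \<comment> \<open>Each function is the derivative of the other, so the induction treats both at
    once.\<close>
  have "C_on k UNIV (cosh::real\<Rightarrow>real) \<and> C_on k UNIV (sinh::real\<Rightarrow>real)" for k
  proof (induction k)
    case 0
    show ?case by (auto intro!: continuous_intros)
  next
    case (Suc k)
    have "C_on (Suc k) UNIV (cosh::real\<Rightarrow>real)"
      by (rule C_on_Suc_realI[where g'=sinh]) (use Suc in \<open>auto intro!: derivative_eq_intros\<close>)
    moreover have "C_on (Suc k) UNIV (sinh::real\<Rightarrow>real)"
      by (rule C_on_Suc_realI[where g'=cosh]) (use Suc in \<open>auto intro!: derivative_eq_intros\<close>)
    ultimately show ?case by blast
  qed
  then show "smooth_on UNIV (cosh::real\<Rightarrow>real)" "smooth_on UNIV (sinh::real\<Rightarrow>real)"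
    by (auto simp: smooth_on_def)
qed

lemma smooth_on_inverse: "smooth_on (-{0}) (inverse :: real \<Rightarrow> real)"
proof -
  have "C_on k (-{0}) (inverse :: real \<Rightarrow> real)" for k
  proof (induction k)
    case 0
    show ?case by (auto intro!: continuous_intros)
  next
    case (Suc k)
    have "C_on k (-{0}) (\<lambda>x::real. (- 1) * (inverse x * inverse x))"
      using Suc by (intro bounded_bilinear.C_on_bilinear[OF bounded_bilinear_mult] C_on_const) auto
    then show ?case
      by (intro C_on_Suc_realI[where g'="\<lambda>x. (- 1) * (inverse x * inverse x)"])
        (auto intro!: derivative_eq_intros)
  qed
  then show ?thesis by (simp add: smooth_on_def)
qed

lemma smooth_on_inverse_sqrt: "smooth_on {0<..} (\<lambda>x::real. 1 / sqrt x)"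
proof -
  \<comment> \<open>Differentiation lowers the exponent by one, so all real exponents are treated
    together; \<open>- (1/2)\<close> is the case wanted.\<close>
  have "C_on k {0<..} (\<lambda>x::real. x powr a)" for k a
  proof (induction k arbitrary: a)
    case 0
    show ?case by (auto intro!: continuous_intros)
  next
    case (Suc k)
    have "C_on k {0<..} (\<lambda>x::real. a * x powr (a - 1))"
      using Suc by (intro bounded_bilinear.C_on_bilinear[OF bounded_bilinear_mult] C_on_const) auto
    then show ?case
      by (intro C_on_Suc_realI[where g'="\<lambda>x. a * x powr (a - 1)"])
        (auto intro!: derivative_eq_intros)
  qed
  then have "smooth_on {0<..} (\<lambda>x::real. x powr (- (1/2)))"
    by (simp add: smooth_on_def)
  then show ?thesis
    by (rule smooth_on_cong[rotated 2]) (auto simp: powr_minus_divide powr_half_sqrt)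
qed

section \<open>Partial derivatives of separated functions\<close>

lemma partial_cong:
  assumes "open U" "p \<in> U" "\<And>q. q \<in> U \<Longrightarrow> f q = g q" "g differentiable (at p)"
  shows "partial i f p = partial i g p"
  using frechet_derivative_transform_within_open[OF assms(4,1,2), of f] assms(3)
  by (simp add: partial_def)

lemma partial_nth:
  assumes "F differentiable (at p)"
  shows "partial i F p $ c = partial i (\<lambda>q. F q $ c) p"
proof -
  have "((\<lambda>q. F q $ c) has_derivative (\<lambda>h. frechet_derivative F (at p) h $ c)) (at p)"
    using assms by (intro bounded_linear.has_derivative[OF bounded_linear_vec_nth])
      (simp add: frechet_derivative_works)
  from frechet_derivative_at[OF this] show ?thesis
    by (metis partial_def)
qed

text \<open>All components of the parametrization and of the Gauss map, and all diagonal metric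
  entries, have this separated form. A partial derivative changes a single factor, so repeated
  differentiation stays within the class.\<close>

definition tensor :: "(real \<Rightarrow> real) \<Rightarrow> (real \<Rightarrow> real) \<Rightarrow> (real \<Rightarrow> real) \<Rightarrow> real^3 \<Rightarrow> real" where
  "tensor a b c q = a (q$1) * b (q$2) * c (q$3)"

lemma has_derivative_tensor:
  assumes "(a has_real_derivative a') (at (p$1))" "(b has_real_derivative b') (at (p$2))"
    "(c has_real_derivative c') (at (p$3))"
  shows "(tensor a b c has_derivative (\<lambda>h. a' * h$1 * b (p$2) * c (p$3) + a (p$1) * b' * h$2 * c (p$3)
      + a (p$1) * b (p$2) * c' * h$3)) (at p)"
proof -
  have n: "((\<lambda>q::real^3. q $ i) has_derivative (\<lambda>h. h $ i)) (at p)" for i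
    by (rule bounded_linear_imp_has_derivative[OF bounded_linear_vec_nth])
  have comp: "((\<lambda>q::real^3. u (q$i)) has_derivative (\<lambda>h. u' * h $ i)) (at p)"
    if "(u has_real_derivative u') (at (p$i))" for u u' i
    using diff_chain_at[OF n that[unfolded has_field_derivative_def]] by (simp add: o_def)
  show ?thesis
    unfolding tensor_def[abs_def]
    by (rule has_derivative_eq_rhs[OF has_derivative_mult[OF has_derivative_mult[OF comp[OF assms(1)] comp[OF assms(2)]] comp[OF assms(3)]]])
      (simp add: fun_eq_iff algebra_simps)
qed

lemma differentiable_tensor:
  assumes "(a has_real_derivative a') (at (p$1))" "(b has_real_derivative b') (at (p$2))"
    "(c has_real_derivative c') (at (p$3))"
  shows "tensor a b c differentiable (at p)"
  using has_derivative_tensor[OF assms] differentiableI by blast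

lemma partial_tensor:
  assumes "(a has_real_derivative a') (at (p$1))" "(b has_real_derivative b') (at (p$2))"
    "(c has_real_derivative c') (at (p$3))"
  shows "partial 1 (tensor a b c) p = a' * b (p$2) * c (p$3)"
    "partial 2 (tensor a b c) p = a (p$1) * b' * c (p$3)"
    "partial 3 (tensor a b c) p = a (p$1) * b (p$2) * c'"
  by (simp_all add: partial_def axis_def frechet_derivative_at[OF has_derivative_tensor[OF assms], symmetric])

lemma smooth_on_tensor:
  assumes "open I" "smooth_on I a" "smooth_on UNIV b" "smooth_on UNIV c"
  shows "smooth_on {p. p$1 \<in> I} (tensor a b c)"
proof -
  have o: "open {p::real^3. p$1 \<in> I}"
    using open_vimage_vec_nth[OF assms(1), of 1] by (simp add: vimage_def)
  have n: "smooth_on {p::real^3. p$1 \<in> I} (\<lambda>q. q $ i)" for i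
    by (intro smooth_on_bounded_linear bounded_linear_vec_nth o)
  show ?thesis unfolding tensor_def[abs_def]
    by (intro smooth_on_mult o smooth_on_compose_real[OF o _ assms(2) n] smooth_on_compose_real[OF o _ assms(3) n]
        smooth_on_compose_real[OF o _ assms(4) n]) auto
qed

section \<open>Diagonal operators and hypersurfaces with nondegenerate metric\<close>

definition diagonal :: "real^'n \<Rightarrow> real^'n^'n" where
  "diagonal v = (\<chi> i j. if i = j then v$i else 0)"

lemma diagonal_nth: "diagonal v $ i $ j = (if i = j then v$i else 0)"
  by (simp add: diagonal_def)

lemma diagonal_mult_nth: "(diagonal v ** A) $ i $ j = v$i * A$i$j"
  by (simp add: matrix_matrix_mult_def diagonal_nth if_distrib[of "\<lambda>x. x * _"] sum.delta' cong: if_cong)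

lemma matrix_inv_diagonal:
  fixes v :: "real^'n"
  assumes "\<And>i. v$i * u$i = 1"
  shows "matrix_inv (diagonal v) = diagonal u"
proof -
  have 1: "diagonal v ** diagonal u = mat 1" "diagonal u ** diagonal v = mat 1"
    using assms by (simp_all add: vec_eq_iff diagonal_mult_nth diagonal_nth mat_def mult.commute)
  then have "\<exists>B. diagonal v ** B = mat 1 \<and> B ** diagonal v = mat 1" by blast
  \<comment> \<open>\<open>matrix_inv\<close> is defined by choice, so only its inverse property is
    available; multiplying by the known inverse identifies it.\<close>
  then have "matrix_inv (diagonal v) ** diagonal v = mat 1"
    unfolding matrix_inv_def by (rule someI2_ex) blast
  then have "matrix_inv (diagonal v) ** (diagonal v ** diagonal u) = diagonal u"
    by (simp add: matrix_mul_assoc matrix_mul_lid)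
  then show ?thesis by (simp add: 1 matrix_mul_rid)
qed

lemma det_diagonal_vec: "det (diagonal v) = (\<Prod>i\<in>UNIV. v$i)"
  by (subst det_diagonal) (auto simp: diagonal_nth)

lemma principal_curvatures_diagonal: "principal_curvatures (diagonal v) v"
  unfolding principal_curvatures_def
proof
  fix x :: real
  have "mat x - diagonal v = diagonal (\<chi> i. x - v$i)"
    by (simp add: vec_eq_iff mat_def diagonal_nth)
  then show "det (mat x - diagonal v) = (\<Prod>i\<in>UNIV. x - v$i)"
    by (simp add: det_diagonal_vec)
qed

text \<open>The \<open>i\<close>-th entry is \<open>a_2 + a_1 * v$i + (v$i)^2\<close>, in which
  every product containing \<open>v$i\<close> cancels.\<close>

lemma newton_transformation_diagonal:
  "newton_transformation (diagonal v) v 2 = diagonal (vector [v$2 * v$3, v$1 * v$3, v$1 * v$2])"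
proof -
  have "newton_transformation (diagonal v) v (Suc (Suc 0)) =
      diagonal (vector [v$2 * v$3, v$1 * v$3, v$1 * v$2])"
    by (simp add: vec_eq_iff forall_3 diagonal_mult_nth diagonal_nth mat_def a_coeff_def algebra_simps)
  then show ?thesis by (simp add: numeral_2_eq_2)
qed

text \<open>Used with \<open>u\<close> from the second Newton transformation and \<open>v\<close>
  from the inverse metric, so that off-diagonal Hessian entries never have to be computed.\<close>

lemma trace_diagonal_mult:
  "trace (diagonal u ** (diagonal v ** A)) = (\<Sum>i\<in>UNIV. u$i * v$i * A$i$i)"
  by (simp add: trace_def diagonal_mult_nth mult.assoc)

lemma vector_4:
  "(vector [a, b, c, d] :: 'a::zero^4) $ 1 = a" "(vector [a, b, c, d] :: 'a^4) $ 2 = b"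
  "(vector [a, b, c, d] :: 'a^4) $ 3 = c" "(vector [a, b, c, d] :: 'a^4) $ 4 = d"
  by (simp_all add: vector_def)

lemma lorentz_sum: "lorentz x (\<Sum>i\<in>A. c i *\<^sub>R y i) = (\<Sum>i\<in>A. c i * lorentz x (y i))"
  by (induction A rule: infinite_finite_induct) (auto simp: lorentz_def algebra_simps)

lemma frechet_derivative_eq_sum_partial:
  fixes F :: "real^'n \<Rightarrow> 'b::real_normed_vector"
  assumes "F differentiable (at p)"
  shows "frechet_derivative F (at p) h = (\<Sum>i\<in>UNIV. h$i *\<^sub>R partial i F p)"
proof -
  have l: "linear (frechet_derivative F (at p))"
    using assms by (rule linear_frechet_derivative)
  have "frechet_derivative F (at p) h = frechet_derivative F (at p) (\<Sum>i\<in>UNIV. h$i *\<^sub>R axis i 1)"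
    using basis_expansion[of h] by (simp add: scalar_mult_eq_scaleR)
  also have "\<dots> = (\<Sum>i\<in>UNIV. h$i *\<^sub>R partial i F p)"
    by (simp add: linear_sum[OF l] linear_scale[OF l] partial_def)
  finally show ?thesis .
qed

text \<open>The entries of the metric applied to \<open>h\<close> are the Lorentz products of the
  coordinate vectors with \<open>dX h\<close>. A kernel vector of \<open>dX\<close> is thus killed
  by an invertible matrix.\<close>

lemma inj_frechet_derivative_of_metric:
  assumes "X differentiable (at p)" "det (metric X p) \<noteq> 0"
  shows "inj (frechet_derivative X (at p))"
proof -
  have l: "linear (frechet_derivative X (at p))"
    using assms(1) by (rule linear_frechet_derivative)
  have "h = 0" if "frechet_derivative X (at p) h = 0" for h
  proof -
    have "(metric X p *v h) $ i = lorentz (partial i X p) (frechet_derivative X (at p) h)" for i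
      by (simp add: frechet_derivative_eq_sum_partial[OF assms(1)] lorentz_sum matrix_vector_mult_def
          metric_def mult.commute)
    then have "metric X p *v h = 0"
      using that by (simp add: vec_eq_iff lorentz_def)
    moreover have "inj ((*v) (metric X p))"
      using assms(2) by (simp add: inj_matrix_vector_mult invertible_det_nz)
    ultimately show ?thesis
      by (metis injD matrix_vector_mult_0_right)
  qed
  then show ?thesis using linear_injective_0[OF l] by blast
qed

text \<open>The definite description needs uniqueness: corresponding columns of two candidates have
  the same image under the injective \<open>dX\<close>.\<close>

lemma shape_operator_eqI:
  assumes "X differentiable (at p)" "det (metric X p) \<noteq> 0"
    and S: "\<And>j. (\<Sum>i\<in>UNIV. S$i$j *\<^sub>R partial i X p) = - partial j N p"
  shows "shape_operator X N p = S"
  unfolding shape_operator_def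
proof (rule the_equality)
  show "\<forall>j. (\<Sum>i\<in>UNIV. S$i$j *\<^sub>R partial i X p) = - partial j N p" using S by blast
next
  fix T assume T: "\<forall>j. (\<Sum>i\<in>UNIV. T$i$j *\<^sub>R partial i X p) = - partial j N p"
  have "(\<chi> i. T$i$j) = (\<chi> i. S$i$j)" for j
  proof (rule injD[OF inj_frechet_derivative_of_metric[OF assms(1,2)]])
    show "frechet_derivative X (at p) (\<chi> i. T$i$j) = frechet_derivative X (at p) (\<chi> i. S$i$j)"
      using T S by (simp add: frechet_derivative_eq_sum_partial[OF assms(1)])
  qed
  then show "T = S" by (simp add: vec_eq_iff)
qed

section \<open>Geometry of the rotational hypersurface\<close>

text \<open>The slope bound makes the \<open>s\<close>-direction timelike, and
  \<open>0 \<notin> I\<close> keeps the rotational directions from collapsing; together they give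
  nondegeneracy of the metric.\<close>

locale rotational_profile =
  fixes I :: "real set" and f :: "real \<Rightarrow> real"
  assumes open_I: "open I" and zero_notin: "0 \<notin> I" and smooth_f: "smooth_on I f"
    and slope: "s \<in> I \<Longrightarrow> (deriv f s)\<^sup>2 < 1"
begin

abbreviation "f1 \<equiv> deriv f"
abbreviation "f2 \<equiv> deriv f1"
abbreviation "f3 \<equiv> deriv f2"
abbreviation "X \<equiv> rot_hypersurface f"
abbreviation "N \<equiv> rot_gauss_map f"
abbreviation "U \<equiv> {p::real^3. p$1 \<in> I}"

definition \<omega> :: "real \<Rightarrow> real" where
  "\<omega> s = 1 / sqrt (1 - (f1 s)\<^sup>2)"

lemma open_U: "open U"
  using open_vimage_vec_nth[OF open_I, of 1] by (simp add: vimage_def)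

lemma smooth_f1: "smooth_on I f1" and smooth_f2: "smooth_on I f2"
  using smooth_on_deriv smooth_f open_I by blast+

lemma D_f:
  assumes "s \<in> I"
  shows "(f has_real_derivative f1 s) (at s)" "(f1 has_real_derivative f2 s) (at s)"
    "(f2 has_real_derivative f3 s) (at s)"
  using smooth_on_imp_DERIV smooth_f smooth_f1 smooth_f2 assms by blast+

lemma omega_pos: "s \<in> I \<Longrightarrow> \<omega> s > 0"
  using slope by (simp add: \<omega>_def)

text \<open>This polynomial relation replaces the square root in the later algebraic
  eliminations.\<close>

lemma omega_sq: "s \<in> I \<Longrightarrow> (\<omega> s)\<^sup>2 * (1 - (f1 s)\<^sup>2) = 1"
  using slope[of s] by (simp add: \<omega>_def power_divide)

lemma D_omega:
  assumes "s \<in> I"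
  shows "(\<omega> has_real_derivative f1 s * f2 s * \<omega> s ^ 3) (at s)"
proof -
  have p: "1 - (f1 s)\<^sup>2 > 0" using slope[OF assms] by simp
  have r: "sqrt (1 - (f1 s)\<^sup>2) ^ 3 = sqrt (1 - (f1 s)\<^sup>2) * (1 - (f1 s)\<^sup>2)"
    using p by (simp add: power3_eq_cube)
  show ?thesis
    unfolding \<omega>_def[abs_def] using p
    by (auto intro!: derivative_eq_intros D_f(2)[OF assms] simp: power_divide r)
      (simp add: field_simps power2_eq_square)
qed

lemma smooth_omega: "smooth_on I \<omega>"
proof -
  have "smooth_on I (\<lambda>s. 1 + (- 1) * (f1 s * f1 s))"
    by (intro smooth_on_add smooth_on_mult smooth_on_const open_I smooth_f1)
  then have "smooth_on I (\<lambda>s. 1 / sqrt (1 + (- 1) * (f1 s * f1 s)))"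
    by (intro smooth_on_compose_real[OF open_I _ smooth_on_inverse_sqrt])
      (use slope in \<open>auto simp: power2_eq_square\<close>)
  then show ?thesis
    by (rule smooth_on_cong[OF open_I, rotated]) (simp add: \<omega>_def power2_eq_square)
qed

lemma X_components:
  "(\<lambda>q. X q $ 1) = tensor (\<lambda>s. s) cosh cosh"
  "(\<lambda>q. X q $ 2) = tensor (\<lambda>s. s) sinh (\<lambda>_. 1)"
  "(\<lambda>q. X q $ 3) = tensor (\<lambda>s. s) cosh sinh"
  "(\<lambda>q. X q $ 4) = tensor f (\<lambda>_. 1) (\<lambda>_. 1)"
  by (auto simp: fun_eq_iff rot_hypersurface_def Let_def tensor_def vector_4)

lemma N_components:
  "(\<lambda>q. N q $ 1) = tensor (\<lambda>s. - (f1 s * \<omega> s)) cosh cosh"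
  "(\<lambda>q. N q $ 2) = tensor (\<lambda>s. - (f1 s * \<omega> s)) sinh (\<lambda>_. 1)"
  "(\<lambda>q. N q $ 3) = tensor (\<lambda>s. - (f1 s * \<omega> s)) cosh sinh"
  "(\<lambda>q. N q $ 4) = tensor (\<lambda>s. - \<omega> s) (\<lambda>_. 1) (\<lambda>_. 1)"
  by (auto simp: fun_eq_iff rot_gauss_map_def Let_def tensor_def vector_4 \<omega>_def)

lemma smooth_X: "smooth_on U X"
proof (rule smooth_on_vec[OF open_U])
  have id: "smooth_on I (\<lambda>s. s)" by (intro smooth_on_bounded_linear bounded_linear_ident open_I)
  have "\<forall>i. smooth_on U (\<lambda>x. X x $ i)"
    by (auto simp: forall_4 X_components intro!: smooth_on_tensor open_I id smooth_f smooth_on_cosh_sinh)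
  then show "smooth_on U (\<lambda>x. X x $ i)" for i by blast
qed

lemma smooth_N: "smooth_on U N"
proof (rule smooth_on_vec[OF open_U])
  have a: "smooth_on I (\<lambda>s. (- 1) * (f1 s * \<omega> s))" "smooth_on I (\<lambda>s. (- 1) * \<omega> s)"
    by (intro smooth_on_mult smooth_on_const open_I smooth_f1 smooth_omega)+
  have "\<forall>i. smooth_on U (\<lambda>x. N x $ i)"
    using a by (auto simp: forall_4 N_components intro!: smooth_on_tensor open_I smooth_on_cosh_sinh)
  then show "smooth_on U (\<lambda>x. N x $ i)" for i by blast
qed

lemma D_hyp:
  "(cosh has_real_derivative sinh t) (at t)" "(sinh has_real_derivative cosh t) (at t)"
  "((\<lambda>_. 1) has_real_derivative 0) (at t)"
  for t :: real
  by (auto intro!: derivative_eq_intros)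

text \<open>The product rule gives \<open>f'' \<omega> + f'^2 f'' \<omega>^3\<close>, and
  \<open>omega_sq\<close> merges the two terms into \<open>f'' \<omega>^3\<close>.\<close>

lemma D_alpha:
  assumes "s \<in> I"
  shows "((\<lambda>s. - (f1 s * \<omega> s)) has_real_derivative - (f2 s * \<omega> s ^ 3)) (at s)"
proof -
  have "((\<lambda>s. - (f1 s * \<omega> s)) has_real_derivative
      - f2 s * \<omega> s - f1 s * (f1 s * f2 s * \<omega> s ^ 3)) (at s)"
    by (auto intro!: derivative_eq_intros D_f(2)[OF assms] D_omega[OF assms])
  moreover have "- f2 s * \<omega> s - f1 s * (f1 s * f2 s * \<omega> s ^ 3) = - (f2 s * \<omega> s ^ 3)"
    using omega_sq[OF assms] by algebra
  ultimately show ?thesis by simp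
qed

lemma D_beta: "s \<in> I \<Longrightarrow> ((\<lambda>s. - \<omega> s) has_real_derivative - (f1 s * f2 s * \<omega> s ^ 3)) (at s)"
  by (auto intro!: derivative_eq_intros D_omega)

lemma D_alpha':
  "s \<in> I \<Longrightarrow> ((\<lambda>s. - (f2 s * \<omega> s ^ 3)) has_real_derivative
     - f3 s * \<omega> s ^ 3 - 3 * f1 s * (f2 s)\<^sup>2 * \<omega> s ^ 5) (at s)"
  by (auto intro!: derivative_eq_intros D_f D_omega simp: power2_eq_square eval_nat_numeral algebra_simps)

lemma D_beta':
  "s \<in> I \<Longrightarrow> ((\<lambda>s. - (f1 s * f2 s * \<omega> s ^ 3)) has_real_derivative
     - ((f2 s)\<^sup>2 + f1 s * f3 s) * \<omega> s ^ 3 - 3 * (f1 s)\<^sup>2 * (f2 s)\<^sup>2 * \<omega> s ^ 5) (at s)"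
  by (auto intro!: derivative_eq_intros D_f D_omega simp: power2_eq_square eval_nat_numeral algebra_simps)

section \<open>Tangent frame, induced metric and unit normal\<close>

lemma partial_X:
  assumes "p \<in> U"
  shows "partial 1 X p = vector [cosh (p$2) * cosh (p$3), sinh (p$2), cosh (p$2) * sinh (p$3), f1 (p$1)]"
    "partial 2 X p = vector [p$1 * sinh (p$2) * cosh (p$3), p$1 * cosh (p$2), p$1 * sinh (p$2) * sinh (p$3), 0]"
    "partial 3 X p = vector [p$1 * cosh (p$2) * sinh (p$3), 0, p$1 * cosh (p$2) * cosh (p$3), 0]"
  using assms
  by (simp_all add: vec_eq_iff forall_4 vector_4 partial_nth[OF smooth_on_imp_differentiable[OF smooth_X assms]]
      X_components partial_tensor[OF DERIV_ident D_hyp(1) D_hyp(1)] partial_tensor[OF DERIV_ident D_hyp(2) D_hyp(3)]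
      partial_tensor[OF DERIV_ident D_hyp(1) D_hyp(2)] partial_tensor[OF D_f(1) D_hyp(3) D_hyp(3)])

text \<open>\<open>N\<close> is built from the same vector \<open>e\<close> as \<open>X\<close>, so
  its derivatives are parallel to the coordinate vectors. The factors are the negated principal
  curvatures, which makes the shape operator diagonal.\<close>

lemma partial_N:
  assumes "p \<in> U"
  shows "partial 1 N p = - (f2 (p$1) * \<omega> (p$1) ^ 3) *\<^sub>R partial 1 X p"
    "partial 2 N p = - (f1 (p$1) * \<omega> (p$1) / p$1) *\<^sub>R partial 2 X p"
    "partial 3 N p = - (f1 (p$1) * \<omega> (p$1) / p$1) *\<^sub>R partial 3 X p"
proof -
  have s: "p$1 \<in> I" "p$1 \<noteq> 0" using assms zero_notin by auto
  show "partial 1 N p = - (f2 (p$1) * \<omega> (p$1) ^ 3) *\<^sub>R partial 1 X p"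
    "partial 2 N p = - (f1 (p$1) * \<omega> (p$1) / p$1) *\<^sub>R partial 2 X p"
    "partial 3 N p = - (f1 (p$1) * \<omega> (p$1) / p$1) *\<^sub>R partial 3 X p"
    using s
    by (simp_all add: vec_eq_iff forall_4 vector_4 partial_X[OF assms]
        partial_nth[OF smooth_on_imp_differentiable[OF smooth_N assms]] N_components
        partial_tensor[OF D_alpha D_hyp(1) D_hyp(1)] partial_tensor[OF D_alpha D_hyp(2) D_hyp(3)]
        partial_tensor[OF D_alpha D_hyp(1) D_hyp(2)] partial_tensor[OF D_beta D_hyp(3) D_hyp(3)])
qed

text \<open>The vector \<open>e\<close> has Lorentz square \<open>-1\<close>. Its derivatives in
  \<open>t\<close> and \<open>w\<close> are orthogonal to it and to each other, with squares
  \<open>1\<close> and \<open>cosh^2 t\<close>.\<close>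

lemma metric_X:
  assumes "p \<in> U"
  shows "metric X p = diagonal (vector [(f1 (p$1))\<^sup>2 - 1, (p$1)\<^sup>2, (p$1)\<^sup>2 * (cosh (p$2))\<^sup>2])"
proof -
  have c: "(cosh x)\<^sup>2 = (sinh x)\<^sup>2 + 1" for x :: real
    by (rule cosh_square_eq)
  show ?thesis
    by (simp add: vec_eq_iff forall_3 metric_def diagonal_nth partial_X[OF assms] lorentz_def vector_4)
      (use c[of "p$2"] c[of "p$3"] in \<open>(intro conjI; algebra)\<close>)
qed

lemma det_metric_X:
  assumes "p \<in> U"
  shows "det (metric X p) \<noteq> 0"
proof -
  have "p$1 \<noteq> 0" using assms zero_notin by auto
  moreover have "(f1 (p$1))\<^sup>2 - 1 \<noteq> 0" using assms slope[of "p$1"] by simp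
  moreover have "cosh (p$2) \<noteq> 0" by simp
  ultimately have "\<forall>i::3. vector [(f1 (p$1))\<^sup>2 - 1, (p$1)\<^sup>2, (p$1)\<^sup>2 * (cosh (p$2))\<^sup>2] $ i \<noteq> (0::real)"
    unfolding forall_3 vector_3 by simp
  then show ?thesis
    unfolding metric_X[OF assms] det_diagonal_vec by (simp add: prod_zero_iff)
qed

lemma matrix_inv_metric_X:
  assumes "p \<in> U"
  shows "matrix_inv (metric X p) =
    diagonal (vector [- (\<omega> (p$1))\<^sup>2, 1 / (p$1)\<^sup>2, 1 / ((p$1)\<^sup>2 * (cosh (p$2))\<^sup>2)])"
proof -
  have "p$1 \<noteq> 0" using assms zero_notin by auto
  then have "\<forall>i::3. vector [(f1 (p$1))\<^sup>2 - 1, (p$1)\<^sup>2, (p$1)\<^sup>2 * (cosh (p$2))\<^sup>2] $ i *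
      vector [- (\<omega> (p$1))\<^sup>2, 1 / (p$1)\<^sup>2, 1 / ((p$1)\<^sup>2 * (cosh (p$2))\<^sup>2)] $ i = 1"
    using omega_sq[of "p$1"] assms by (simp add: forall_3 vector_3 algebra_simps)
  then show ?thesis
    unfolding metric_X[OF assms] by (intro matrix_inv_diagonal) blast
qed

text \<open>The Lorentz square of the first three components is \<open>- s^2\<close>, which recovers
  \<open>s\<close> up to sign; positivity of \<open>cosh\<close> in the first component fixes the
  sign. Injectivity of \<open>sinh\<close> then yields \<open>t\<close> and afterwards
  \<open>w\<close>.\<close>

lemma inj_X: "inj_on X U"
proof (rule inj_onI)
  fix p q assume p: "p \<in> U" and q: "q \<in> U" and "X p = X q"
  then have e: "p$1 * cosh (p$2) * cosh (p$3) = q$1 * cosh (q$2) * cosh (q$3)"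
    "p$1 * sinh (p$2) = q$1 * sinh (q$2)"
    "p$1 * cosh (p$2) * sinh (p$3) = q$1 * cosh (q$2) * sinh (q$3)"
    by (simp_all add: vec_eq_iff forall_4 rot_hypersurface_def Let_def vector_4)
  have nz: "p$1 \<noteq> 0" "q$1 \<noteq> 0" using p q zero_notin by auto
  have sq: "(x * cosh t * cosh w)\<^sup>2 - (x * sinh t)\<^sup>2 - (x * cosh t * sinh w)\<^sup>2 = x\<^sup>2" for x t w :: real
    by (simp add: power_mult_distrib cosh_square_eq algebra_simps)
  have "(p$1)\<^sup>2 = (q$1)\<^sup>2" using sq[of "p$1" "p$2" "p$3"] sq[of "q$1" "q$2" "q$3"] e by simp
  moreover have "p$1 \<noteq> - q$1"
  proof
    assume "p$1 = - q$1"
    with e(1) have "q$1 * (cosh (p$2) * cosh (p$3) + cosh (q$2) * cosh (q$3)) = 0"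
      by (simp add: algebra_simps)
    then show False using nz cosh_real_pos[of "p$2"] cosh_real_pos[of "p$3"] cosh_real_pos[of "q$2"]
        cosh_real_pos[of "q$3"] by (metis add_pos_pos less_irrefl mult_eq_0_iff mult_pos_pos)
  qed
  ultimately have 1: "p$1 = q$1" using power2_eq_iff by blast
  with e nz have 2: "p$2 = q$2" by simp
  with 1 e nz have "p$3 = q$3" by simp
  with 1 2 show "p = q" by (simp add: vec_eq_iff forall_3)
qed

text \<open>From \<open><e, e> = -1\<close> the square of \<open>N\<close> is
  \<open>\<omega>^2 (1 - f'^2) = 1\<close>, so the sign is \<open>+1\<close>. In the product with
  the \<open>s\<close>-derivative the two contributions \<open>f'\<close> cancel, and the
  derivatives of \<open>e\<close> in \<open>t\<close> and \<open>w\<close> are orthogonal to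
  \<open>e\<close>.\<close>

lemma oriented_hypersurface_X: "oriented_hypersurface U X N"
proof -
  have normal: "\<forall>i. lorentz (N p) (partial i X p) = 0" and unit: "lorentz (N p) (N p) = 1" if "p \<in> U" for p
  proof -
    have N: "N p $ 1 = - f1 (p$1) * \<omega> (p$1) * cosh (p$2) * cosh (p$3)"
      "N p $ 2 = - f1 (p$1) * \<omega> (p$1) * sinh (p$2)"
      "N p $ 3 = - f1 (p$1) * \<omega> (p$1) * cosh (p$2) * sinh (p$3)" "N p $ 4 = - \<omega> (p$1)"
      using N_components[THEN fun_cong, of p] by (simp_all add: tensor_def)
    have c: "(cosh x)\<^sup>2 = (sinh x)\<^sup>2 + 1" for x :: real
      by (rule cosh_square_eq)
    show "\<forall>i. lorentz (N p) (partial i X p) = 0"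
      by (simp add: forall_3 lorentz_def partial_X[OF that] N vector_4)
        (use c[of "p$2"] c[of "p$3"] in \<open>(intro conjI; algebra)\<close>)
    show "lorentz (N p) (N p) = 1"
      unfolding lorentz_def N using omega_sq[of "p$1"] that c[of "p$2"] c[of "p$3"]
      by (simp only: mem_Collect_eq) algebra
  qed
  show ?thesis
    unfolding oriented_hypersurface_def
    using open_U smooth_X smooth_N inj_X det_metric_X normal unit
      inj_frechet_derivative_of_metric[OF smooth_on_imp_differentiable[OF smooth_X]]
    by blast
qed

section \<open>Shape operator and principal curvatures\<close>

definition \<kappa>1 :: "real \<Rightarrow> real" where
  "\<kappa>1 s = f2 s * \<omega> s ^ 3"

definition \<kappa>2 :: "real \<Rightarrow> real" where
  "\<kappa>2 s = f1 s * \<omega> s / s"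

definition \<kappa> :: "real^3 \<Rightarrow> real^3" where
  "\<kappa> p = vector [\<kappa>1 (p$1), \<kappa>2 (p$1), \<kappa>2 (p$1)]"

lemma shape_operator_X:
  assumes "p \<in> U"
  shows "shape_operator X N p = diagonal (\<kappa> p)"
proof (rule shape_operator_eqI[OF smooth_on_imp_differentiable[OF smooth_X assms] det_metric_X[OF assms]])
  have "\<forall>j. (\<Sum>i\<in>UNIV. diagonal (\<kappa> p) $ i $ j *\<^sub>R partial i X p) = - partial j N p"
    by (simp add: forall_3 sum_3 diagonal_nth \<kappa>_def vector_3 partial_N[OF assms] \<kappa>1_def \<kappa>2_def)
  then show "(\<Sum>i\<in>UNIV. diagonal (\<kappa> p) $ i $ j *\<^sub>R partial i X p) = - partial j N p" for j
    by blast
qed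

section \<open>Levi-Civita connection of the induced metric\<close>

lemma partial_metric_X:
  assumes "p \<in> U"
  shows "partial k (\<lambda>q. metric X q $ i $ j) p =
    (if i \<noteq> j then 0
     else if i = 1 then (if k = 1 then 2 * f1 (p$1) * f2 (p$1) else 0)
     else if i = 2 then (if k = 1 then 2 * p$1 else 0)
     else (if k = 1 then 2 * p$1 * (cosh (p$2))\<^sup>2
           else if k = 2 then 2 * (p$1)\<^sup>2 * cosh (p$2) * sinh (p$2) else 0))"
proof -
  have s: "p$1 \<in> I" using assms by simp
  have D1: "((\<lambda>s. (f1 s)\<^sup>2 - 1) has_real_derivative 2 * f1 (p$1) * f2 (p$1)) (at (p$1))"
    by (auto intro!: derivative_eq_intros D_f[OF s])
  have D2: "((\<lambda>s. s\<^sup>2) has_real_derivative 2 * x) (at x)" for x :: real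
    by (auto intro!: derivative_eq_intros)
  have D3: "((\<lambda>t. (cosh t)\<^sup>2) has_real_derivative 2 * cosh t * sinh t) (at t)" for t :: real
    by (auto intro!: derivative_eq_intros)
  \<comment> \<open>The diagonal form of the metric is known on \<open>U\<close> only; openness of
    \<open>U\<close> allows it to be differentiated there.\<close>
  have 0: "partial k (\<lambda>q. metric X q $ i $ j) p = 0" if "i \<noteq> j"
    by (subst partial_cong[OF open_U assms, where g="\<lambda>_. 0"])
      (auto simp: metric_X diagonal_nth that partial_def)
  have 1: "partial k (\<lambda>q. metric X q $ 1 $ 1) p = partial k (tensor (\<lambda>s. (f1 s)\<^sup>2 - 1) (\<lambda>_. 1) (\<lambda>_. 1)) p"
    by (rule partial_cong[OF open_U assms _ differentiable_tensor[OF D1 D_hyp(3) D_hyp(3)]])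
      (simp add: metric_X diagonal_nth vector_3 tensor_def)
  have 2: "partial k (\<lambda>q. metric X q $ 2 $ 2) p = partial k (tensor (\<lambda>s. s\<^sup>2) (\<lambda>_. 1) (\<lambda>_. 1)) p"
    by (rule partial_cong[OF open_U assms _ differentiable_tensor[OF D2 D_hyp(3) D_hyp(3)]])
      (simp add: metric_X diagonal_nth vector_3 tensor_def)
  have 3: "partial k (\<lambda>q. metric X q $ 3 $ 3) p = partial k (tensor (\<lambda>s. s\<^sup>2) (\<lambda>t. (cosh t)\<^sup>2) (\<lambda>_. 1)) p"
    by (rule partial_cong[OF open_U assms _ differentiable_tensor[OF D2 D3 D_hyp(3)]])
      (simp add: metric_X diagonal_nth vector_3 tensor_def)
  have "i = 1 \<or> i = 2 \<or> i = 3" "k = 1 \<or> k = 2 \<or> k = 3" using exhaust_3 by blast+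
  then show ?thesis
    using 0 1 2 3
    by (cases "i = j") (auto simp: partial_tensor[OF D1 D_hyp(3) D_hyp(3)]
        partial_tensor[OF D2 D_hyp(3) D_hyp(3)] partial_tensor[OF D2 D3 D_hyp(3)])
qed

text \<open>Symbols with equal lower indices suffice, since the trace defining L_2 sees only the
  diagonal of the Hessian.\<close>

lemma christoffel_X:
  assumes "p \<in> U"
  shows "christoffel X 1 1 1 p = - (\<omega> (p$1))\<^sup>2 * f1 (p$1) * f2 (p$1)"
    "christoffel X 2 1 1 p = 0" "christoffel X 3 1 1 p = 0"
    "christoffel X 1 2 2 p = (\<omega> (p$1))\<^sup>2 * p$1" "christoffel X 2 2 2 p = 0" "christoffel X 3 2 2 p = 0"
    "christoffel X 1 3 3 p = (\<omega> (p$1))\<^sup>2 * p$1 * (cosh (p$2))\<^sup>2"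
    "christoffel X 2 3 3 p = - cosh (p$2) * sinh (p$2)" "christoffel X 3 3 3 p = 0"
proof -
  have "p$1 \<noteq> 0" using assms zero_notin by auto
  then show "christoffel X 1 1 1 p = - (\<omega> (p$1))\<^sup>2 * f1 (p$1) * f2 (p$1)"
    "christoffel X 2 1 1 p = 0" "christoffel X 3 1 1 p = 0"
    "christoffel X 1 2 2 p = (\<omega> (p$1))\<^sup>2 * p$1" "christoffel X 2 2 2 p = 0" "christoffel X 3 2 2 p = 0"
    "christoffel X 1 3 3 p = (\<omega> (p$1))\<^sup>2 * p$1 * (cosh (p$2))\<^sup>2"
    "christoffel X 2 3 3 p = - cosh (p$2) * sinh (p$2)" "christoffel X 3 3 3 p = 0"
    by (simp_all add: christoffel_def sum_3 matrix_inv_metric_X[OF assms] diagonal_nth vector_3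
        partial_metric_X[OF assms])
qed

text \<open>The weights come from the diagonal of the second Newton transformation, namely
  \<open>\<kappa>2^2\<close> once and \<open>\<kappa>1 \<kappa>2\<close> twice, times the inverse
  metric. The quotient by \<open>s^2\<close> contains the Laplacian of the hyperbolic plane
  \<open>dt^2 + cosh^2 t dw^2\<close>.\<close>

lemma L_op_tensor:
  assumes p: "p \<in> U"
    and a: "\<And>s. s \<in> I \<Longrightarrow> (a has_real_derivative a' s) (at s)"
    and a': "\<And>s. s \<in> I \<Longrightarrow> (a' has_real_derivative a'' s) (at s)"
    and b: "\<And>t. (b has_real_derivative b' t) (at t)" "\<And>t. (b' has_real_derivative b'' t) (at t)"
    and c: "\<And>t. (c has_real_derivative c' t) (at t)" "\<And>t. (c' has_real_derivative c'' t) (at t)"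
  shows "L_op 2 X N \<kappa> (tensor a b c) p =
    - (\<kappa>2 (p$1))\<^sup>2 * (\<omega> (p$1))\<^sup>2 * (a'' (p$1) + (\<omega> (p$1))\<^sup>2 * f1 (p$1) * f2 (p$1) * a' (p$1)) * b (p$2) * c (p$3)
    + \<kappa>1 (p$1) * \<kappa>2 (p$1) *
      ((a (p$1) * b'' (p$2) * c (p$3) + a (p$1) * b (p$2) * c'' (p$3) / (cosh (p$2))\<^sup>2
         + a (p$1) * (sinh (p$2) / cosh (p$2)) * b' (p$2) * c (p$3)) / (p$1)\<^sup>2
       - 2 * (\<omega> (p$1))\<^sup>2 * a' (p$1) * b (p$2) * c (p$3) / p$1)"
proof -
  have s: "p$1 \<in> I" "p$1 \<noteq> 0" using p zero_notin by auto
  \<comment> \<open>\<open>a'\<close> is known to be the derivative of \<open>a\<close> only on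
    \<open>I\<close>, so the inner partial derivative is replaced on the open set \<open>U\<close>
    before the outer one is taken.\<close>
  have 1: "partial 1 (partial 1 (tensor a b c)) p = partial 1 (tensor a' b c) p"
    by (rule partial_cong[OF open_U p _ differentiable_tensor[OF a'[OF s(1)] b(1) c(1)]])
      (simp add: partial_tensor[OF a b(1) c(1)] tensor_def)
  have 2: "partial 2 (partial 2 (tensor a b c)) p = partial 2 (tensor a b' c) p"
    by (rule partial_cong[OF open_U p _ differentiable_tensor[OF a[OF s(1)] b(2) c(1)]])
      (simp add: partial_tensor[OF a b(1) c(1)] tensor_def)
  have 3: "partial 3 (partial 3 (tensor a b c)) p = partial 3 (tensor a b c') p"
    by (rule partial_cong[OF open_U p _ differentiable_tensor[OF a[OF s(1)] b(1) c(2)]])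
      (simp add: partial_tensor[OF a b(1) c(1)] tensor_def)
  note d = 1 2 3 partial_tensor[OF a[OF s(1)] b(1) c(1)] partial_tensor[OF a'[OF s(1)] b(1) c(1)]
    partial_tensor[OF a[OF s(1)] b(2) c(1)] partial_tensor[OF a[OF s(1)] b(1) c(2)]
  show ?thesis
    using s(2)
    by (simp add: L_op_def shape_operator_X[OF p] newton_transformation_diagonal hessian_operator_def
        matrix_inv_metric_X[OF p] trace_diagonal_mult sum_3 vector_3 covariant_hessian_def
        christoffel_X[OF p] d \<kappa>_def)
      (simp add: field_simps power2_eq_square)
qed

text \<open>This is \<open>- 3 H_1 H_3\<close>, the coefficient of \<open>N\<close> in the known
  formula for \<open>L_2 N\<close> with \<open>\<epsilon> = 1\<close>. The repeated product in place
  of a square suits \<open>smooth_on_mult\<close>.\<close>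

definition \<mu> :: "real \<Rightarrow> real" where
  "\<mu> s = - (\<kappa>1 s * (\<kappa>2 s * \<kappa>2 s) * (\<kappa>1 s + 2 * \<kappa>2 s))"

lemma smooth_kappa: "smooth_on I \<kappa>1" "smooth_on I \<kappa>2"
proof -
  have "smooth_on I (\<lambda>s. f2 s * (\<omega> s * (\<omega> s * \<omega> s)))"
    by (intro smooth_on_mult open_I smooth_f2 smooth_omega)
  then show "smooth_on I \<kappa>1"
    by (rule smooth_on_cong[OF open_I, rotated]) (simp add: \<kappa>1_def power3_eq_cube)
  have "smooth_on I (\<lambda>s. inverse s)"
    by (rule smooth_on_compose_real[OF open_I _ smooth_on_inverse
        smooth_on_bounded_linear[OF bounded_linear_ident open_I]]) (use zero_notin in auto)
  then have "smooth_on I (\<lambda>s. f1 s * \<omega> s * inverse s)"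
    by (intro smooth_on_mult open_I smooth_f1 smooth_omega)
  then show "smooth_on I \<kappa>2"
    by (rule smooth_on_cong[OF open_I, rotated]) (simp add: \<kappa>2_def divide_inverse)
qed

lemma smooth_mu: "smooth_on U (\<lambda>p. \<mu> (p$1))"
proof -
  have "smooth_on I (\<lambda>s. (- 1) * (\<kappa>1 s * (\<kappa>2 s * \<kappa>2 s) * (\<kappa>1 s + 2 * \<kappa>2 s)))"
    by (intro smooth_on_mult smooth_on_add smooth_on_const open_I smooth_kappa)
  then have m: "smooth_on I \<mu>"
    by (rule smooth_on_cong[OF open_I, rotated]) (simp add: \<mu>_def)
  have n: "smooth_on U (\<lambda>p. p$1)"
    by (intro smooth_on_bounded_linear bounded_linear_vec_nth open_U)
  show ?thesis
    by (rule smooth_on_compose_real[OF open_U _ m n]) auto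
qed

text \<open>The hypothesis \<open>ode\<close> is the vanishing of the logarithmic derivative of
  \<open>\<kappa>1 \<kappa>2^2\<close>, multiplied by \<open>f' f''\<close> and simplified by
  \<open>omega_sq\<close>. It is the vanishing of the gradient term of \<open>H_3\<close>.\<close>

lemma L_op_N:
  assumes p: "p \<in> U"
    and ode: "f1 (p$1) * f3 (p$1) = 2 * f1 (p$1) * f2 (p$1) / p$1
      - (f2 (p$1))\<^sup>2 * (3 * (f1 (p$1))\<^sup>2 + 2) * (\<omega> (p$1))\<^sup>2"
  shows "L_op_vec 2 X N \<kappa> N p = \<mu> (p$1) *\<^sub>R N p"
proof -
  \<comment> \<open>Treating \<open>1 / s\<close> as an atom turns the identities below into
    polynomial ones.\<close>
  define u where "u = 1 / p$1"
  note w = omega_sq[of "p$1"]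
  have s: "p$1 \<in> I" "p$1 \<noteq> 0" using p zero_notin by auto
  have k: "\<kappa>1 (p$1) = f2 (p$1) * \<omega> (p$1) ^ 3" "\<kappa>2 (p$1) = f1 (p$1) * \<omega> (p$1) * u"
    by (simp_all add: \<kappa>1_def \<kappa>2_def u_def)
  have d: "x / p$1 = x * u" "x / (p$1)\<^sup>2 = x * u\<^sup>2" for x
    by (simp_all add: u_def power_divide)
  note ode' = ode[unfolded d]
  have c: "(cosh x)\<^sup>2 = (sinh x)\<^sup>2 + 1" for x :: real
    by (rule cosh_square_eq)
  \<comment> \<open>The common factor that L_2 produces in front of \<open>e\<close> in the first
    three components; the \<open>2\<close> before \<open>u^2\<close> is the hyperbolic eigenvalue of
    \<open>e\<close>.\<close>
  define A where "A = - (\<kappa>2 (p$1))\<^sup>2 * (\<omega> (p$1))\<^sup>2 * ((- f3 (p$1) * \<omega> (p$1) ^ 3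
        - 3 * f1 (p$1) * (f2 (p$1))\<^sup>2 * \<omega> (p$1) ^ 5)
        + (\<omega> (p$1))\<^sup>2 * f1 (p$1) * f2 (p$1) * (- (f2 (p$1) * \<omega> (p$1) ^ 3)))
      + \<kappa>1 (p$1) * \<kappa>2 (p$1) * (2 * (- (f1 (p$1) * \<omega> (p$1))) * u\<^sup>2
        - 2 * (\<omega> (p$1))\<^sup>2 * (- (f2 (p$1) * \<omega> (p$1) ^ 3)) * u)"
  have A: "A = \<mu> (p$1) * (- (f1 (p$1) * \<omega> (p$1)))"
    unfolding A_def \<mu>_def k using ode' w[OF s(1)] by algebra
  \<comment> \<open>The last component is constant in \<open>t\<close> and \<open>w\<close>, so the
    hyperbolic Laplacian contributes nothing here.\<close>
  have B: "- (\<kappa>2 (p$1))\<^sup>2 * (\<omega> (p$1))\<^sup>2 * ((- ((f2 (p$1))\<^sup>2 + f1 (p$1) * f3 (p$1)) * \<omega> (p$1) ^ 3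
        - 3 * (f1 (p$1))\<^sup>2 * (f2 (p$1))\<^sup>2 * \<omega> (p$1) ^ 5)
        + (\<omega> (p$1))\<^sup>2 * f1 (p$1) * f2 (p$1) * (- (f1 (p$1) * f2 (p$1) * \<omega> (p$1) ^ 3)))
      - \<kappa>1 (p$1) * \<kappa>2 (p$1) * (2 * (\<omega> (p$1))\<^sup>2 * (- (f1 (p$1) * f2 (p$1) * \<omega> (p$1) ^ 3)) * u)
      = \<mu> (p$1) * (- \<omega> (p$1))"
    unfolding \<mu>_def k using ode' w[OF s(1)] by algebra
  \<comment> \<open>The coordinates of \<open>e\<close> are eigenfunctions of the hyperbolic
    Laplacian with eigenvalue \<open>2\<close>; this is the case of those containing
    \<open>cosh t\<close>.\<close>
  have h: "a * cosh t * y + a * cosh t * y / (cosh t)\<^sup>2 + a * (sinh t / cosh t) * sinh t * y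
      = 2 * a * cosh t * y" for a t y :: real
  proof -
    have "a * cosh t * y / (cosh t)\<^sup>2 + a * (sinh t / cosh t) * sinh t * y = a * y * (1 + (sinh t)\<^sup>2) / cosh t"
      by (simp add: field_simps power2_eq_square)
    also have "\<dots> = a * y * (cosh t * cosh t) / cosh t"
      using c[of t] by (simp add: power2_eq_square)
    finally show ?thesis by simp
  qed
  have 1: "L_op 2 X N \<kappa> (tensor (\<lambda>s. - (f1 s * \<omega> s)) cosh cosh) p = A * cosh (p$2) * cosh (p$3)"
    by (rule trans[OF L_op_tensor[OF p D_alpha D_alpha' D_hyp(1,2) D_hyp(1,2)]], assumption, assumption)
      (unfold h d A_def, algebra)
  have 2: "L_op 2 X N \<kappa> (tensor (\<lambda>s. - (f1 s * \<omega> s)) sinh (\<lambda>_. 1)) p = A * sinh (p$2)"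
    by (rule trans[OF L_op_tensor[OF p D_alpha D_alpha' D_hyp(2,1) D_hyp(3) DERIV_const]], assumption, assumption)
      (simp add: d A_def algebra_simps)
  have 3: "L_op 2 X N \<kappa> (tensor (\<lambda>s. - (f1 s * \<omega> s)) cosh sinh) p = A * cosh (p$2) * sinh (p$3)"
    by (rule trans[OF L_op_tensor[OF p D_alpha D_alpha' D_hyp(1,2) D_hyp(2,1)]], assumption, assumption)
      (unfold h d A_def, algebra)
  have 4: "L_op 2 X N \<kappa> (tensor (\<lambda>s. - \<omega> s) (\<lambda>_. 1) (\<lambda>_. 1)) p = \<mu> (p$1) * (- \<omega> (p$1))"
    by (rule trans[OF L_op_tensor[OF p D_beta D_beta' D_hyp(3) DERIV_const D_hyp(3) DERIV_const]], assumption, assumption)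
      (use B in \<open>simp add: d\<close>)
  show ?thesis
    using N_components[THEN fun_cong, of p]
    by (simp add: vec_eq_iff forall_4 L_op_vec_def N_components 1 2 3 4 A tensor_def)
qed

text \<open>If \<open>\<mu>\<close> vanished identically, then \<open>\<kappa>1 = - 2 * \<kappa>2\<close>; differentiating this relation and comparing
  with the differential equation leaves only \<open>f1 = 0\<close>.\<close>

lemma mu_nonzero:
  assumes "I \<noteq> {}" and f1: "\<forall>s\<in>I. f1 s \<noteq> 0" and f2: "\<forall>s\<in>I. f2 s \<noteq> 0"
    and ode: "\<And>s. s \<in> I \<Longrightarrow> f1 s * f3 s = 2 * f1 s * f2 s / s - (f2 s)\<^sup>2 * (3 * (f1 s)\<^sup>2 + 2) * (\<omega> s)\<^sup>2"
  shows "\<exists>s\<in>I. \<mu> s \<noteq> 0"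
proof (rule ccontr)
  assume z: "\<not> (\<exists>s\<in>I. \<mu> s \<noteq> 0)"
  have e: "f2 s * (\<omega> s)\<^sup>2 * s + 2 * f1 s = 0" if "s \<in> I" for s
  proof -
    have s: "s \<noteq> 0" using that zero_notin by auto
    have "\<kappa>1 s \<noteq> 0" "\<kappa>2 s \<noteq> 0"
      using f1 f2 that omega_pos[OF that] s by (auto simp: \<kappa>1_def \<kappa>2_def)
    then have "\<kappa>1 s + 2 * \<kappa>2 s = 0" using z that by (auto simp: \<mu>_def)
    then have "\<omega> s * (f2 s * (\<omega> s)\<^sup>2 * s + 2 * f1 s) = 0"
      using s by (simp add: \<kappa>1_def \<kappa>2_def field_simps power2_eq_square power3_eq_cube)
    then show ?thesis using omega_pos[OF that] by simp
  qed
  obtain s where s: "s \<in> I" using assms(1) by blast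
  have "((\<lambda>s. f2 s * (\<omega> s)\<^sup>2 * s + 2 * f1 s) has_real_derivative
      (f3 s * (\<omega> s)\<^sup>2 + f2 s * (2 * \<omega> s * (f1 s * f2 s * \<omega> s ^ 3))) * s + f2 s * (\<omega> s)\<^sup>2 + 2 * f2 s) (at s)"
    by (auto intro!: derivative_eq_intros D_f[OF s] D_omega[OF s] simp: algebra_simps)
  \<comment> \<open>By \<open>e\<close> the function vanishes on all of the open set
    \<open>I\<close>, hence so does its derivative.\<close>
  moreover have "((\<lambda>s. f2 s * (\<omega> s)\<^sup>2 * s + 2 * f1 s) has_real_derivative 0) (at s)"
    using e s by (intro has_field_derivative_transform_within_open[OF DERIV_const open_I s]) auto
  ultimately have d: "(f3 s * (\<omega> s)\<^sup>2 + f2 s * (2 * \<omega> s * (f1 s * f2 s * \<omega> s ^ 3))) * s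
      + f2 s * (\<omega> s)\<^sup>2 + 2 * f2 s = 0"
    by (rule DERIV_unique)
  have s0: "s \<noteq> 0" using s zero_notin by auto
  have o: "f1 s * f3 s * s = 2 * f1 s * f2 s - s * (f2 s)\<^sup>2 * (3 * (f1 s)\<^sup>2 + 2) * (\<omega> s)\<^sup>2"
    using ode[OF s] s0 by (simp add: field_simps)
  \<comment> \<open>Multiplying \<open>d\<close> by \<open>f1 s\<close> and inserting
    \<open>o\<close>, \<open>e\<close> and \<open>omega_sq\<close> leaves
    \<open>9 * f1 s * f2 s * (\<omega> s)^2 = 0\<close>. Multiplying by \<open>s\<close> and using
    \<open>e\<close> once more gives \<open>(f1 s)^2 = 0\<close>.\<close>
  have "(f1 s)\<^sup>2 = 0 \<or> (\<omega> s) = 0 \<or> s = 0"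
    using e[OF s] d o omega_sq[OF s] by algebra
  then show False using f1 s s0 omega_pos[OF s] by auto
qed

end

theorem theorem10:
  fixes I :: "real set" and f :: "real \<Rightarrow> real"
  assumes "open I" and "is_interval I" and "I \<noteq> {}" and "0 \<notin> I"
    and "smooth_on I f"
    and "\<forall>s\<in>I. (deriv f s)\<^sup>2 < 1"
    and "\<forall>s\<in>I. deriv f s \<noteq> 0"
    and "\<forall>s\<in>I. deriv (deriv f) s \<noteq> 0"
    and "\<forall>s\<in>I. deriv (deriv (deriv f)) s / deriv (deriv f) s =
      (s * (3 * (deriv f s)\<^sup>2 + 2) * deriv (deriv f) s + 2 * deriv f s * ((deriv f s)\<^sup>2 - 1)) /
      (s * deriv f s * ((deriv f s)\<^sup>2 - 1))"
  shows "oriented_hypersurface {p. p$1 \<in> I} (rot_hypersurface f) (rot_gauss_map f) \<and>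
    first_kind_L_pointwise_1_type_Gauss_map 2 {p. p$1 \<in> I} (rot_hypersurface f) (rot_gauss_map f)"
proof -
  interpret rotational_profile I f
    using assms by unfold_locales auto
  \<comment> \<open>Clearing denominators and writing \<open>1 / (f'^2 - 1)\<close> as
    \<open>- \<omega>^2\<close> brings the given equation into the form that eliminates
    \<open>f' f'''\<close>.\<close>
  have ode: "f1 s * f3 s = 2 * f1 s * f2 s / s - (f2 s)\<^sup>2 * (3 * (f1 s)\<^sup>2 + 2) * (\<omega> s)\<^sup>2"
    if s: "s \<in> I" for s
  proof -
    have nz: "s \<noteq> 0" "f1 s \<noteq> 0" "f2 s \<noteq> 0" "(f1 s)\<^sup>2 - 1 \<noteq> 0"
      using assms s by (auto simp: less_le)
    have "(\<omega> s)\<^sup>2 * ((f1 s)\<^sup>2 - 1) = - 1"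
      using omega_sq[OF s] by (simp add: algebra_simps)
    then have w: "(\<omega> s)\<^sup>2 = - 1 / ((f1 s)\<^sup>2 - 1)"
      by (rule eq_divide_imp[OF nz(4)])
    have "f3 s / f2 s = (s * (3 * (f1 s)\<^sup>2 + 2) * f2 s + 2 * f1 s * ((f1 s)\<^sup>2 - 1)) /
        (s * f1 s * ((f1 s)\<^sup>2 - 1))"
      using assms s by blast
    then have "f3 s * (s * f1 s * ((f1 s)\<^sup>2 - 1)) =
        (s * (3 * (f1 s)\<^sup>2 + 2) * f2 s + 2 * f1 s * ((f1 s)\<^sup>2 - 1)) * f2 s"
      using nz by (simp add: frac_eq_eq)
    then have "f1 s * f3 s = (s * (3 * (f1 s)\<^sup>2 + 2) * f2 s + 2 * f1 s * ((f1 s)\<^sup>2 - 1)) * f2 s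
        / (s * ((f1 s)\<^sup>2 - 1))"
      using nz by (simp add: eq_divide_eq mult_ac)
    also have "\<dots> = 2 * f1 s * f2 s / s - (f2 s)\<^sup>2 * (3 * (f1 s)\<^sup>2 + 2) * (\<omega> s)\<^sup>2"
      unfolding w using nz by (simp add: divide_simps power2_eq_square) (simp add: algebra_simps)
    finally show ?thesis .
  qed
  obtain s where s: "s \<in> I" "\<mu> s \<noteq> 0"
    using mu_nonzero[OF assms(3,7,8) ode] by blast
  \<comment> \<open>The factor depends on \<open>s\<close> alone, so any point over a good
    \<open>s\<close> serves; the other two coordinates are set to \<open>0\<close>.\<close>
  have "\<exists>p\<in>U. \<mu> (p$1) \<noteq> 0"
    by (rule bexI[of _ "vector [s, 0, 0]"]) (use s in auto)
  moreover have "\<forall>p\<in>U. principal_curvatures (shape_operator X N p) (\<kappa> p)"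
    by (simp add: shape_operator_X principal_curvatures_diagonal)
  moreover have "\<forall>p\<in>U. L_op_vec 2 X N \<kappa> N p = \<mu> (p$1) *\<^sub>R N p"
    by (intro ballI L_op_N ode) auto
  ultimately have "first_kind_L_pointwise_1_type_Gauss_map 2 U X N"
    unfolding first_kind_L_pointwise_1_type_Gauss_map_def
    using smooth_mu by (intro exI[of _ \<kappa>] exI[of _ "\<lambda>p. \<mu> (p$1)"]) blast
  then show ?thesis using oriented_hypersurface_X by blast
qed

end
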